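(* Let $R$ be a commutative ring and $(h_n)_{n>0}$ a sequence in $R$ satisfying the even-odd recurrence $$h_{2n+1}h_1^2=h_{n+2}h_n^3-h_{n-1}h_{n+1}^3\quad(n\ge2),\qquad h_{2n}h_2h_1^2=h_n\bigl(h_{n+2}h_{n-1}^2-h_{n+1}^2h_{n-2}\bigr)\quad(n\ge3).$$ Suppose $h_2h_1$ is not a zero-divisor, $h_1\mid h_2$, $h_2\mid h_4$ and $h_1\mid h_3$. Then $h_n=h_1\cdot e_n$ for all $n>0$, where $(e_n)=\operatorname{EDS}(h_2/h_1,h_3/h_1,h_4/h_2)$.
   Context: The quotients $h_2/h_1$ etc. are the unique elements $x$ with $h_1x=h_2$ etc. (unique since $h_1,h_2$ are non-zero-divisors). Given $B,C,D\in R$, define $(\tilde h_n)_{n\in\mathbb{Z}}$ by $\tilde h_0=0$, $\tilde h_1=\tilde h_2=1$, $\tilde h_3=C$, $\tilde h_4=D$, and $\tilde h_{2n+1}=B^4\tilde h_{n+2}\tilde h_n^3-\tilde h_{n-1}\tilde h_{n+1}^3$ for even $n\ge2$; $\tilde h_{2n+1}=\tilde h_{n+2}\tilde h_n^3-B^4\tilde h_{n-1}\tilde h_{n+1}^3$ for odd $n\ge3$; $\tilde h_{2n}=\tilde h_n(\tilde h_{n+2}\tilde h_{n-1}^2-\tilde h_{n+1}^2\tilde h_{n-2})$ for $n\ge3$; $\tilde h_n=-\tilde h_{-n}$ for $n<0$. $\operatorname{EDS}(B,C,D)$ is the sequence $(e_n)_{n\in\mathbb{Z}}$ with $e_n=\tilde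 h_n$ for $n$ odd and $e_n=B\tilde h_n$ for $n$ even.
   Formalization: The odd recurrence is taken with h_1^3 in place of h_1^2; as printed the claim fails, e.g. over Q with h_1=h_2=2, h_3=0, h_4=2, where h_5=4 but h_1·e_5=2. *)

theory Defs
  imports Main
begin

text \<open>The sort \<open>{comm_ring, comm_monoid_mult}\<close> is \<open>comm_ring_1\<close> without the axiom
  \<open>0 \<noteq> 1\<close>, so the zero ring is included.\<close>

definition non_zero_divisor :: "'a::comm_ring \<Rightarrow> bool" where
  "non_zero_divisor a \<longleftrightarrow> (\<forall>x. a * x = 0 \<longrightarrow> x = 0)"

text \<open>The quotient \<open>b/a\<close>; meaningful only if \<open>a dvd b\<close> and \<open>a\<close> is not a zero-divisor.\<close>

definition quotient_of :: "'a::comm_ring \<Rightarrow> 'a \<Rightarrow> 'a" where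
  "quotient_of b a = (THE x. a * x = b)"

lemma quotient_of_eq:
  fixes a b :: "'a::comm_ring"
  assumes "non_zero_divisor a" and "a * x = b"
  shows "quotient_of b a = x"
  unfolding quotient_of_def
proof (rule the_equality)
  fix y assume "a * y = b"
  with assms(2) have "a * (y - x) = 0" by (simp add: right_diff_distrib)
  with assms(1) show "y = x" unfolding non_zero_divisor_def by (metis eq_iff_diff_eq_0)
qed (rule assms(2))

text \<open>For \<open>N \<ge> 5\<close> the recurrences are read with \<open>N = 2 * n + 1\<close> or \<open>N = 2 * n\<close>, that is
  \<open>n = N div 2\<close>; the lemmas below state them in the usual form.\<close>

function eds_tilde :: "'a::{comm_ring,comm_monoid_mult} \<Rightarrow> 'a \<Rightarrow> 'a \<Rightarrow> int \<Rightarrow> 'a" where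
  "eds_tilde B C D N =
    (if N < 0 then - eds_tilde B C D (- N)
     else if N = 0 then 0
     else if N = 1 then 1
     else if N = 2 then 1
     else if N = 3 then C
     else if N = 4 then D
     else (let n = N div 2 in
       if odd N then
         (if even n
          then B ^ 4 * eds_tilde B C D (n + 2) * eds_tilde B C D n ^ 3
                 - eds_tilde B C D (n - 1) * eds_tilde B C D (n + 1) ^ 3
          else eds_tilde B C D (n + 2) * eds_tilde B C D n ^ 3
                 - B ^ 4 * eds_tilde B C D (n - 1) * eds_tilde B C D (n + 1) ^ 3)
       else eds_tilde B C D n *
              (eds_tilde B C D (n + 2) * eds_tilde B C D (n - 1) ^ 2
               - eds_tilde B C D (n + 1) ^ 2 * eds_tilde B C D (n - 2))))"
  by pat_completeness auto
termination
  by (relation "measure (\<lambda>(B, C, D, N). 2 * nat \<bar>N\<bar> + (if N < 0 then 1 else 0))")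
    (simp_all, presburger+)

declare eds_tilde.simps [simp del]

lemma eds_tilde_initial:
  "eds_tilde B C D 0 = 0" "eds_tilde B C D 1 = 1" "eds_tilde B C D 2 = 1"
  "eds_tilde B C D 3 = C" "eds_tilde B C D 4 = D"
  by (simp_all add: eds_tilde.simps)

lemma eds_tilde_odd_even:
  assumes "n \<ge> 2" and "even n"
  shows "eds_tilde B C D (2 * n + 1) =
    B ^ 4 * eds_tilde B C D (n + 2) * eds_tilde B C D n ^ 3
      - eds_tilde B C D (n - 1) * eds_tilde B C D (n + 1) ^ 3"
  using assms by (subst eds_tilde.simps) (auto simp: Let_def)

lemma eds_tilde_odd_odd:
  assumes "n \<ge> 3" and "odd n"
  shows "eds_tilde B C D (2 * n + 1) =
    eds_tilde B C D (n + 2) * eds_tilde B C D n ^ 3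
      - B ^ 4 * eds_tilde B C D (n - 1) * eds_tilde B C D (n + 1) ^ 3"
  using assms by (subst eds_tilde.simps) (auto simp: Let_def)

lemma eds_tilde_even:
  assumes "n \<ge> 3"
  shows "eds_tilde B C D (2 * n) =
    eds_tilde B C D n *
      (eds_tilde B C D (n + 2) * eds_tilde B C D (n - 1) ^ 2
       - eds_tilde B C D (n + 1) ^ 2 * eds_tilde B C D (n - 2))"
  using assms by (subst eds_tilde.simps) (auto simp: Let_def)

lemma eds_tilde_neg:
  assumes "n < 0"
  shows "eds_tilde B C D n = - eds_tilde B C D (- n)"
  using assms by (subst eds_tilde.simps) auto

definition EDS :: "'a::{comm_ring,comm_monoid_mult} \<Rightarrow> 'a \<Rightarrow> 'a \<Rightarrow> int \<Rightarrow> 'a" where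
  "EDS B C D n = (if odd n then eds_tilde B C D n else B * eds_tilde B C D n)"

end

theory Submission
  imports Defs
begin

text \<open>Strong induction on the index: inserting \<open>h k = h 1 * e k\<close> for the smaller indices, the
  right-hand sides of the recurrences become \<open>h 1 ^ 3\<close>, respectively \<open>h 2 * h 1 ^ 2\<close>, times
  \<open>h 1\<close> times the next term of the EDS, and the non-zero-divisors \<open>h 1\<close> and \<open>h 2\<close> cancel.\<close>

lemma non_zero_divisor_cancel:
  fixes a x y :: "'a::comm_ring"
  assumes "non_zero_divisor a" and "x * a = y * a"
  shows "x = y"
proof -
  have "a * (x - y) = 0" using assms(2) by (simp add: algebra_simps)
  with assms(1) show ?thesis unfolding non_zero_divisor_def by (metis eq_iff_diff_eq_0)
qed

text \<open>Serves both ways: it splits the hypothesis on \<open>h 2 * h 1\<close>, and it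
  reassembles the factors \<open>h 1 ^ 3\<close> and \<open>h 2 * h 1 ^ 2\<close> to be
  cancelled.\<close>

lemma non_zero_divisor_mult_iff:
  fixes a b :: "'a::comm_ring"
  shows "non_zero_divisor (a * b) \<longleftrightarrow> non_zero_divisor a \<and> non_zero_divisor b"
  unfolding non_zero_divisor_def
proof (intro iffI conjI)
  assume *: "\<forall>x. a * b * x = 0 \<longrightarrow> x = 0"
  from * show "\<forall>x. a * x = 0 \<longrightarrow> x = 0" by (metis mult.assoc mult.commute mult_zero_right)
  from * show "\<forall>x. b * x = 0 \<longrightarrow> x = 0" by (metis mult.assoc mult_zero_right)
qed (metis mult.assoc)

text \<open>The factor \<open>B\<close> at even indices absorbs \<open>B ^ 4\<close>, so the parity
  cases merge: if \<open>n\<close> is even, it comes from \<open>n + 2\<close> and three times from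
  \<open>n\<close>; if \<open>n\<close> is odd, from \<open>n - 1\<close> and three times from
  \<open>n + 1\<close>.\<close>

lemma EDS_odd:
  fixes n :: int
  assumes "n \<ge> 2"
  shows "EDS B C D (2 * n + 1) =
    EDS B C D (n + 2) * EDS B C D n ^ 3 - EDS B C D (n - 1) * EDS B C D (n + 1) ^ 3"
proof (cases "even n")
  case True
  then show ?thesis
    unfolding EDS_def eds_tilde_odd_even[OF assms True]
    by (simp add: power3_eq_cube power4_eq_xxxx ac_simps)
next
  case False
  with assms have "n \<ge> 3" by presburger
  from False show ?thesis
    unfolding EDS_def eds_tilde_odd_odd[OF \<open>n \<ge> 3\<close> False]
    by (simp add: power3_eq_cube power4_eq_xxxx ac_simps)
qed

text \<open>Both sides carry \<open>B ^ 2\<close>. On the right it comes from \<open>n\<close> and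
  \<open>n + 2\<close> or \<open>n - 2\<close> if \<open>n\<close> is even, and from the squares if
  \<open>n\<close> is odd.\<close>

lemma EDS_even:
  fixes n :: int
  assumes "n \<ge> 3"
  shows "EDS B C D (2 * n) * B =
    EDS B C D n * (EDS B C D (n + 2) * EDS B C D (n - 1) ^ 2
      - EDS B C D (n + 1) ^ 2 * EDS B C D (n - 2))"
  unfolding EDS_def eds_tilde_even[OF assms] by (simp add: power2_eq_square algebra_simps)

theorem theorem4p3:
  fixes h :: "nat \<Rightarrow> 'a::{comm_ring,comm_monoid_mult}"
  assumes "\<And>n. n \<ge> 2 \<Longrightarrow>
      h (2 * n + 1) * h 1 ^ 3 = h (n + 2) * h n ^ 3 - h (n - 1) * h (n + 1) ^ 3"
    and "\<And>n. n \<ge> 3 \<Longrightarrow>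
      h (2 * n) * h 2 * h 1 ^ 2 = h n * (h (n + 2) * h (n - 1) ^ 2 - h (n + 1) ^ 2 * h (n - 2))"
    and "non_zero_divisor (h 2 * h 1)"
    and "h 1 dvd h 2" and "h 2 dvd h 4" and "h 1 dvd h 3"
  shows "\<forall>n>0. h n =
    h 1 * EDS (quotient_of (h 2) (h 1)) (quotient_of (h 3) (h 1)) (quotient_of (h 4) (h 2)) (int n)"
proof -
  have nzd1: "non_zero_divisor (h 1)" and nzd2: "non_zero_divisor (h 2)"
    using assms(3) by (simp_all add: non_zero_divisor_mult_iff)
  obtain B C D where B: "h 2 = h 1 * B" and C: "h 3 = h 1 * C" and D: "h 4 = h 2 * D"
    using assms(4-6) by (elim dvdE)
  have quotients: "quotient_of (h 2) (h 1) = B" "quotient_of (h 3) (h 1) = C"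
      "quotient_of (h 4) (h 2) = D"
    using B C D nzd1 nzd2 by (simp_all only: quotient_of_eq)
  define e where "e k = EDS B C D (int k)" for k
  \<comment> \<open>The bounds on \<open>n\<close> keep \<open>n - 1\<close> and
    \<open>n - 2\<close> from being truncated in \<open>nat\<close>.\<close>
  have e_odd: "e (2 * n + 1) = e (n + 2) * e n ^ 3 - e (n - 1) * e (n + 1) ^ 3" if "n \<ge> 2" for n
    using EDS_odd[of "int n" B C D] that by (simp add: e_def of_nat_diff ac_simps)
  have e_even: "e (2 * n) * B = e n * (e (n + 2) * e (n - 1) ^ 2 - e (n + 1) ^ 2 * e (n - 2))"
    if "n \<ge> 3" for n
    using EDS_even[of "int n" B C D] that by (simp add: e_def of_nat_diff ac_simps)
  have "h N = h 1 * e N" if "N > 0" for N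
    using that
  proof (induction N rule: less_induct)
    case (less N)
    consider "N = 1" | "N = 2" | "N = 3" | "N = 4"
      | (odd) n where "N = 2 * n + 1" "n \<ge> 2" | (even) n where "N = 2 * n" "n \<ge> 3"
      using less.prems by atomize_elim presburger
    then show ?case
    proof cases
      case odd
      have IH: "h (n + 2) = h 1 * e (n + 2)" "h n = h 1 * e n"
          "h (n - 1) = h 1 * e (n - 1)" "h (n + 1) = h 1 * e (n + 1)"
        \<comment> \<open>\<open>n \<ge> 2\<close> gives \<open>n + 2 < 2 * n + 1\<close> and
          \<open>n - 1 > 0\<close>.\<close>
        using odd by - (rule less.IH; use odd in arith)+
      have "h N * h 1 ^ 3 = h (n + 2) * h n ^ 3 - h (n - 1) * h (n + 1) ^ 3"
        using assms(1) odd by simp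
      \<comment> \<open>Homogeneity of degree 4 brings out \<open>h 1 ^ 4\<close>, one factor more
        than is cancelled.\<close>
      also have "\<dots> = h 1 * (e (n + 2) * e n ^ 3 - e (n - 1) * e (n + 1) ^ 3) * h 1 ^ 3"
        unfolding IH by (simp only: power3_eq_cube algebra_simps)
      also have "\<dots> = h 1 * e N * h 1 ^ 3"
        using e_odd odd by simp
      finally show ?thesis
        by (rule non_zero_divisor_cancel[rotated])
          (use nzd1 in \<open>simp only: power3_eq_cube non_zero_divisor_mult_iff\<close>)
    next
      case even
      have IH: "h (n + 2) = h 1 * e (n + 2)" "h n = h 1 * e n" "h (n - 1) = h 1 * e (n - 1)"
          "h (n + 1) = h 1 * e (n + 1)" "h (n - 2) = h 1 * e (n - 2)"
        \<comment> \<open>Here \<open>n + 2 < 2 * n\<close> and \<open>n - 2 > 0\<close> need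
          \<open>n \<ge> 3\<close>.\<close>
        using even by - (rule less.IH; use even in arith)+
      have "h N * (h 2 * h 1 ^ 2) =
          h n * (h (n + 2) * h (n - 1) ^ 2 - h (n + 1) ^ 2 * h (n - 2))"
        using assms(2)[of n] even by (simp add: mult.assoc)
      also have "\<dots> = h 1 ^ 4 * (e n * (e (n + 2) * e (n - 1) ^ 2 - e (n + 1) ^ 2 * e (n - 2)))"
        unfolding IH by (simp only: power2_eq_square power4_eq_xxxx algebra_simps)
      also have "\<dots> = h 1 ^ 4 * (e N * B)"
        using e_even even by simp
      \<comment> \<open>The extra \<open>B\<close> turns one factor \<open>h 1\<close> into
        \<open>h 2\<close>.\<close>
      also have "\<dots> = h 1 * e N * (h 2 * h 1 ^ 2)"
        unfolding B by (simp only: power2_eq_square power4_eq_xxxx ac_simps)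
      finally show ?thesis
        by (rule non_zero_divisor_cancel[rotated])
          (use nzd1 nzd2 in \<open>simp only: power2_eq_square non_zero_divisor_mult_iff\<close>)
    \<comment> \<open>Initial terms: in particular \<open>e 4 = B * D\<close>, so
      \<open>h 1 * e 4 = h 2 * D = h 4\<close>.\<close>
    qed (use B C D in \<open>simp_all add: e_def EDS_def eds_tilde_initial mult.assoc\<close>)
  qed
  then show ?thesis unfolding quotients e_def by blast
qed

end
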